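(* Let $G$ be an infinite, cubic, bridgeless, connected graph, and let $p,k$ be positive integers with $p\le k$. (1) If every finite, cubic, bridgeless, connected graph has a $(k,p)$-PM cover, then $G$ also has a $(k,p)$-PM cover. (2) If every finite, cubic, bridgeless, connected graph has a $(k,p)^*$-PM cover, then $G$ also has a $(k,p)^*$-PM cover.
   Context: Graphs are simple (no loops, no parallel edges) and may be infinite. A graph is cubic if every vertex has degree exactly 3, and bridgeless if it has no edge whose deletion increases the number of connected components. A perfect matching of $G$ is a set $M\subseteq E(G)$ such that every vertex of $G$ is incident with exactly one edge of $M$. Let $k,p$ be positive integers with $p\le k$. A $(k,p)$-PM cover (perfect matching cover) of a graph $G$ is a collection $M_1,\dots,M_k$ of $k$ (not necessarily distinct) perfect matchings of $G$ such that each edge of $G$ belongs to at most $p$ of them (i.e. $|\{j : e\in M_j\}|\le p$ for every $e\in E(G)$). A $(k,p)^*$-PM cover of $G$ is a collection $M_1,\dots,M_k$ of $k$ (not necessarily distinct) perfect matchings of $G$ such that each edge of $G$ belongs to at least $p$ of them (i.e. $|\{j : e\in M_j\}|\ge p$ for every $e\in E(G)$). *)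

theory Defs
  imports Main
begin

text \<open>A graph is given by a vertex set \<open>V\<close> and a set \<open>E\<close> of edges, an edge being the two-element
  set of its ends.  Both sets may be infinite.\<close>

definition simple_graph :: "'a set \<Rightarrow> 'a set set \<Rightarrow> bool" where
  "simple_graph V E \<longleftrightarrow> (\<forall>e\<in>E. \<exists>u\<in>V. \<exists>v\<in>V. u \<noteq> v \<and> e = {u, v})"

text \<open>\<open>card\<close> is 0 on infinite sets, so a cubic graph is in particular locally finite.\<close>

definition degree :: "'a set set \<Rightarrow> 'a \<Rightarrow> nat" where
  "degree E v = card {e \<in> E. v \<in> e}"

definition cubic :: "'a set \<Rightarrow> 'a set set \<Rightarrow> bool" where
  "cubic V E \<longleftrightarrow> (\<forall>v\<in>V. degree E v = 3)"

definition joined :: "'a set \<Rightarrow> 'a set set \<Rightarrow> ('a \<times> 'a) set" where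
  "joined V E = {(u, v). u \<in> V \<and> v \<in> V \<and> (u, v) \<in> {(x, y). {x, y} \<in> E}\<^sup>*}"

definition connected_graph :: "'a set \<Rightarrow> 'a set set \<Rightarrow> bool" where
  "connected_graph V E \<longleftrightarrow> V \<noteq> {} \<and> (\<forall>u\<in>V. \<forall>v\<in>V. (u, v) \<in> joined V E)"

definition components :: "'a set \<Rightarrow> 'a set set \<Rightarrow> 'a set set" where
  "components V E = V // joined V E"

text \<open>Deleting an edge splits at most one component into two, so the two sets of components below
  are both finite or both infinite.  In the infinite case their numbers are equal, and \<open>card\<close>, which
  is then 0 on both sides, gives the right answer there as well.\<close>

definition bridge :: "'a set \<Rightarrow> 'a set set \<Rightarrow> 'a set \<Rightarrow> bool" where
  "bridge V E e \<longleftrightarrow> e \<in> E \<and> card (components V E) < card (components V (E - {e}))"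

definition bridgeless :: "'a set \<Rightarrow> 'a set set \<Rightarrow> bool" where
  "bridgeless V E \<longleftrightarrow> (\<nexists>e. bridge V E e)"

definition perfect_matching :: "'a set \<Rightarrow> 'a set set \<Rightarrow> 'a set set \<Rightarrow> bool" where
  "perfect_matching V E M \<longleftrightarrow> M \<subseteq> E \<and> (\<forall>v\<in>V. \<exists>!e. e \<in> M \<and> v \<in> e)"

definition has_PM_cover :: "nat \<Rightarrow> nat \<Rightarrow> 'a set \<Rightarrow> 'a set set \<Rightarrow> bool" where
  "has_PM_cover k p V E \<longleftrightarrow>
    (\<exists>M :: nat \<Rightarrow> 'a set set. (\<forall>j\<in>{1..k}. perfect_matching V E (M j)) \<and>
      (\<forall>e\<in>E. card {j \<in> {1..k}. e \<in> M j} \<le> p))"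

definition has_PM_cover_star :: "nat \<Rightarrow> nat \<Rightarrow> 'a set \<Rightarrow> 'a set set \<Rightarrow> bool" where
  "has_PM_cover_star k p V E \<longleftrightarrow>
    (\<exists>M :: nat \<Rightarrow> 'a set set. (\<forall>j\<in>{1..k}. perfect_matching V E (M j)) \<and>
      (\<forall>e\<in>E. card {j \<in> {1..k}. e \<in> M j} \<ge> p))"

text \<open>Every finite graph has an isomorphic copy with vertices in \<open>nat\<close>, so a statement about all
  graphs satisfying the following predicate is one about all finite graphs of this kind.\<close>

definition finite_cubic_bridgeless_connected :: "nat set \<Rightarrow> nat set set \<Rightarrow> bool" where
  "finite_cubic_bridgeless_connected V E \<longleftrightarrow>
    simple_graph V E \<and> finite V \<and> cubic V E \<and> bridgeless V E \<and> connected_graph V E"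

end

theory Submission
  imports "HOL-Analysis.Function_Topology" Defs
begin

text \<open>For a finite connected \<open>X \<subseteq> V\<close>, take three disjoint copies of \<open>G[X]\<close> and, for every edge \<open>e\<close>
  leaving \<open>X\<close>, one new vertex joined to the three copies of the end of \<open>e\<close> in \<open>X\<close>. The result \<open>H\<close> is a
  finite simple cubic graph. It is connected and bridgeless: after deletion of an edge, the two copies
  of \<open>X\<close> not incident with it and all the new vertices remain connected to each other, and each
  vertex of the third copy still reaches a new vertex, since \<open>G\<close> minus an edge is
  connected and infinite. The matchings of a cover of \<open>H\<close> restrict to the edges that meet one copy of
  \<open>X\<close>, so all the conditions at finitely many vertices of \<open>G\<close> can be met simultaneously, and a cover of \<open>G\<close> follows by
  compactness.\<close>

section \<open>Compactness\<close>

text \<open>Fixing the values of \<open>f\<close> on \<open>D\<close> and leaving every other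
  coordinate free gives a basic open set around \<open>f\<close>, because only finitely many factors
  are proper subsets. By \<open>dep\<close> it stays inside the set in question.\<close>

lemma openin_product_discrete:
  fixes P :: "('i \<Rightarrow> bool) \<Rightarrow> bool"
  assumes "finite D" and dep: "\<And>f g. (\<forall>d\<in>D. f d = g d) \<Longrightarrow> P f = P g"
  shows "openin (product_topology (\<lambda>_. discrete_topology UNIV) UNIV) {f. P f}"
proof (subst openin_subopen, intro ballI)
  fix f assume "f \<in> {f. P f}"
  define B where "B = PiE UNIV (\<lambda>d. if d \<in> D then {f d} else UNIV)"
  have "finite {i. (if i \<in> D then {f i} else UNIV) \<noteq> (UNIV :: bool set)}"
    by (rule finite_subset[OF _ \<open>finite D\<close>]) auto
  then have "openin (product_topology (\<lambda>_. discrete_topology UNIV) UNIV) B"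
    unfolding B_def by (subst openin_PiE_gen) simp
  moreover have "f \<in> B"
    by (auto simp: B_def PiE_def)
  moreover have "B \<subseteq> {f. P f}"
  proof
    fix g assume "g \<in> B"
    then have "g d \<in> (if d \<in> D then {f d} else UNIV)" for d
      unfolding B_def by (blast dest: PiE_mem)
    then have "\<forall>d\<in>D. g d = f d"
      by (metis singletonD)
    then show "g \<in> {f. P f}"
      using dep[of g f] \<open>f \<in> {f. P f}\<close> by simp
  qed
  ultimately show "\<exists>T. openin (product_topology (\<lambda>_. discrete_topology UNIV) UNIV) T
      \<and> f \<in> T \<and> T \<subseteq> {f. P f}"
    by blast
qed

text \<open>Tychonoff's theorem for a product of two-point discrete spaces. The negation of a
  condition depends on the same finitely many coordinates, so its solution set is open and that of
  the condition is closed; \<open>sat\<close> supplies the finite intersection property.\<close>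

lemma propositional_compactness:
  fixes P :: "'c \<Rightarrow> ('i \<Rightarrow> bool) \<Rightarrow> bool"
  assumes fin: "\<And>c. c \<in> C \<Longrightarrow> finite (D c)"
    and dep: "\<And>c f g. c \<in> C \<Longrightarrow> (\<forall>d\<in>D c. f d = g d) \<Longrightarrow> P c f = P c g"
    and sat: "\<And>S. finite S \<Longrightarrow> S \<subseteq> C \<Longrightarrow> \<exists>f. \<forall>c\<in>S. P c f"
  shows "\<exists>f. \<forall>c\<in>C. P c f"
proof -
  let ?T = "product_topology (\<lambda>_::'i. discrete_topology (UNIV :: bool set)) UNIV"
  let ?U = "(\<lambda>c. {f. P c f}) ` C"
  have "compact_space ?T"
    by (simp add: compact_space_product_topology compact_space_discrete_topology)
  moreover have "closedin ?T S" if S: "S \<in> ?U" for S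
  proof -
    obtain c where c: "c \<in> C" "S = {f. P c f}"
      using S by blast
    have "openin ?T {f. \<not> P c f}"
      by (rule openin_product_discrete[of "D c"]) (use fin dep c in auto)
    moreover have "UNIV - S = {f. \<not> P c f}"
      using c by auto
    ultimately show ?thesis
      by (simp add: closedin_def PiE_UNIV_domain)
  qed
  moreover have "\<Inter>\<F> \<noteq> {}" if F: "finite \<F>" "\<F> \<subseteq> ?U" for \<F>
  proof -
    obtain S where "finite S" "S \<subseteq> C" "\<F> = (\<lambda>c. {f. P c f}) ` S"
      using finite_subset_image[OF F] by blast
    then show ?thesis
      using sat[of S] by blast
  qed
  ultimately have "\<Inter>?U \<noteq> {}"
    unfolding compact_space_fip[of ?T] by meson
  then show ?thesis
    by blast
qed

section \<open>Connectivity\<close>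

abbreviation reach :: "'a set set \<Rightarrow> ('a \<times> 'a) set" where
  "reach E \<equiv> {(x, y). {x, y} \<in> E}\<^sup>*"

lemma reach_sym: "(x, y) \<in> reach E \<Longrightarrow> (y, x) \<in> reach E"
proof -
  have "sym {(x, y). {x, y} \<in> E}"
    by (auto simp: sym_def insert_commute)
  then show "(x, y) \<in> reach E \<Longrightarrow> (y, x) \<in> reach E"
    by (meson sym_rtrancl symD)
qed

lemma reach_edge: "{x, y} \<in> E \<Longrightarrow> (x, y) \<in> reach E"
  by (simp add: r_into_rtrancl)

lemma reach_mono: "E \<subseteq> F \<Longrightarrow> (x, y) \<in> reach E \<Longrightarrow> (x, y) \<in> reach F"
  using rtrancl_mono[of "{(x, y). {x, y} \<in> E}" "{(x, y). {x, y} \<in> F}"] by blast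

lemma joined_iff: "(x, y) \<in> joined V E \<longleftrightarrow> x \<in> V \<and> y \<in> V \<and> (x, y) \<in> reach E"
  by (simp add: joined_def)

lemma simple_graph_edge:
  assumes "simple_graph V E" "e \<in> E"
  shows "e \<subseteq> V" "e \<noteq> {}"
  using assms by (auto simp: simple_graph_def)

lemma equiv_joined: "equiv V (joined V E)"
  by (rule equivI)
    (auto simp: refl_on_def sym_def trans_def joined_iff intro: reach_sym rtrancl_trans)

lemma connected_graphI:
  assumes "\<And>y. y \<in> V \<Longrightarrow> (r, y) \<in> reach E" "r \<in> V"
  shows "connected_graph V E"
  unfolding connected_graph_def joined_iff
proof (intro conjI ballI)
  fix x y assume "x \<in> V" "y \<in> V"
  then show "(x, y) \<in> reach E"
    using rtrancl_trans[OF reach_sym[OF assms(1)] assms(1)] by blast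
qed (use assms(2) in auto)

lemma connected_graphD:
  "\<lbrakk>connected_graph V E; x \<in> V; y \<in> V\<rbrakk> \<Longrightarrow> (x, y) \<in> reach E"
  by (simp add: connected_graph_def joined_iff)

lemma components_connected:
  assumes "connected_graph V E"
  shows "components V E = {V}"
proof -
  have "joined V E `` {x} = V" if "x \<in> V" for x
    using assms that by (auto simp: connected_graph_def joined_iff)
  moreover have "V \<noteq> {}"
    using assms by (simp add: connected_graph_def)
  ultimately show ?thesis
    by (auto simp: components_def quotient_def)
qed

text \<open>Every vertex still reaches an end of \<open>e\<close>. Were the two ends separated,
  their classes would be the only components, and the passage from one component to two would make
  \<open>e\<close> a bridge.\<close>

lemma connected_delete_edge:
  assumes G: "simple_graph V E" "bridgeless V E" "connected_graph V E"
  shows "connected_graph V (E - {e})"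
proof (cases "e \<in> E")
  case True
  then obtain u v where uv: "u \<in> V" "v \<in> V" "e = {u, v}"
    using G(1) unfolding simple_graph_def by blast
  let ?J = "joined V (E - {e})"
  have reach_end: "(u, y) \<in> reach (E - {e}) \<or> (v, y) \<in> reach (E - {e})" if y: "(u, y) \<in> reach E" for y
    using y
  proof (induction rule: rtrancl_induct)
    case (step y z)
    then have yz: "{y, z} \<in> E"
      by simp
    show ?case
    proof (cases "{y, z} = e")
      case True
      \<comment> \<open>A walk that crosses \<open>e\<close> arrives at an end of \<open>e\<close>,
        so everything before can be replaced by the trivial walk from that end.\<close>
      then have "z = u \<or> z = v"
        using uv by auto
      then show ?thesis
        by auto
    next
      case False
      then have "(y, z) \<in> reach (E - {e})"
        using yz by (intro reach_edge) simp
      then show ?thesis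
        using step.IH by (meson rtrancl_trans)
    qed
  qed simp
  have cover: "(u, y) \<in> ?J \<or> (v, y) \<in> ?J" if "y \<in> V" for y
    using reach_end[of y] G(3) uv that by (auto simp: connected_graph_def joined_iff)
  have "(u, v) \<in> ?J"
  proof (rule ccontr)
    assume not_joined: "(u, v) \<notin> ?J"
    have "components V (E - {e}) = {?J `` {u}, ?J `` {v}}"
    proof
      show "components V (E - {e}) \<subseteq> {?J `` {u}, ?J `` {v}}"
      proof
        fix C assume "C \<in> components V (E - {e})"
        then obtain y where "y \<in> V" "C = ?J `` {y}"
          unfolding components_def by (auto elim: quotientE)
        then show "C \<in> {?J `` {u}, ?J `` {v}}"
          using cover[of y] equiv_class_eq[OF equiv_joined] by fast
      qed
      show "{?J `` {u}, ?J `` {v}} \<subseteq> components V (E - {e})"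
        using uv by (auto simp: components_def intro: quotientI)
    qed
    moreover have "?J `` {u} \<noteq> ?J `` {v}"
      using not_joined uv eq_equiv_class[OF _ equiv_joined] by metis
    ultimately have "card (components V (E - {e})) = 2"
      by simp
    then have "bridge V E e"
      using True components_connected[OF G(3)] by (simp add: bridge_def)
    then show False
      using G(2) by (simp add: bridgeless_def)
  qed
  then have "(u, y) \<in> reach (E - {e})" if "y \<in> V" for y
    using cover[OF that] by (auto simp: joined_iff intro: rtrancl_trans)
  then show ?thesis
    using uv(1) by (rule connected_graphI)
next
  case False
  then show ?thesis
    using G(3) by simp
qed

text \<open>Each vertex of \<open>S\<close> lies on a finite path from a common root. A union of
  finite sets connected to the root is again finite and connected to it, since walks survive when
  the induced subgraph grows.\<close>

lemma finite_connected_superset: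
  assumes G: "simple_graph V E" "connected_graph V E" and S: "finite S" "S \<subseteq> V"
  obtains X where "finite X" "S \<subseteq> X" "X \<subseteq> V" "connected_graph X {e \<in> E. e \<subseteq> X}"
proof -
  obtain o' where o': "o' \<in> V"
    using G(2) by (auto simp: connected_graph_def)
  let ?R = "\<lambda>X x. (o', x) \<in> reach {e \<in> E. e \<subseteq> X}"
  have path: "\<exists>X. finite X \<and> X \<subseteq> V \<and> o' \<in> X \<and> s \<in> X \<and> (\<forall>x\<in>X. ?R X x)" if "(o', s) \<in> reach E" for s
    using that
  proof (induction rule: rtrancl_induct)
    case base
    show ?case
      using o' by (intro exI[of _ "{o'}"]) simp
  next
    case (step y z)
    then obtain X where X: "finite X" "X \<subseteq> V" "o' \<in> X" "y \<in> X" "\<forall>x\<in>X. ?R X x"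
      by blast
    have yz: "{y, z} \<in> E"
      using step by simp
    then have "z \<in> V"
      using simple_graph_edge[OF G(1) yz] by simp
    moreover have old: "?R (insert z X) x" if "x \<in> X" for x
      by (rule reach_mono[of "{e \<in> E. e \<subseteq> X}"]) (use X that in auto)
    moreover have "(y, z) \<in> reach {e \<in> E. e \<subseteq> insert z X}"
      using yz X by (intro reach_edge) auto
    then have "?R (insert z X) z"
      using old[OF X(4)] by (rule rtrancl_trans[rotated])
    ultimately show ?case
      using X by (intro exI[of _ "insert z X"]) auto
  qed
  have "\<exists>X. finite X \<and> S \<subseteq> X \<and> X \<subseteq> V \<and> o' \<in> X \<and> (\<forall>x\<in>X. ?R X x)"
    using S
  proof (induction rule: finite_induct)
    case empty
    show ?case
      using path[of o'] by auto
  next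
    case (insert s S)
    then obtain X where X: "finite X" "S \<subseteq> X" "X \<subseteq> V" "o' \<in> X" "\<forall>x\<in>X. ?R X x"
      using insert.IH by blast
    have "s \<in> V"
      using insert.prems by simp
    from path[OF connected_graphD[OF G(2) o' this]]
    obtain Y where Y: "finite Y" "Y \<subseteq> V" "o' \<in> Y" "s \<in> Y" "\<forall>x\<in>Y. ?R Y x"
      by blast
    have "?R (X \<union> Y) x" if "x \<in> X \<union> Y" for x
    proof -
      have "{e \<in> E. e \<subseteq> X} \<subseteq> {e \<in> E. e \<subseteq> X \<union> Y}" "{e \<in> E. e \<subseteq> Y} \<subseteq> {e \<in> E. e \<subseteq> X \<union> Y}"
        by auto
      note mono = this[THEN reach_mono]
      show ?thesis
        using that mono X(5) Y(5) by (elim UnE) simp_all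
    qed
    then show ?case
      using X Y by (intro exI[of _ "X \<union> Y"]) auto
  qed
  then obtain X where X: "finite X" "S \<subseteq> X" "X \<subseteq> V" "o' \<in> X" "\<forall>x\<in>X. ?R X x"
    by blast
  have "connected_graph X {e \<in> E. e \<subseteq> X}"
    using X(4,5) by (intro connected_graphI) auto
  then show thesis
    using X that by blast
qed

section \<open>The closure of a finite part\<close>

text \<open>The names of the new graph's vertices are left abstract: \<open>\<phi> i x\<close> is
  copy number \<open>i\<close> of \<open>x\<close>, and \<open>\<psi> e\<close> is the extra vertex
  for an edge \<open>e\<close> leaving \<open>X\<close>. Injectivity is asked for only on and around
  the finite set \<open>X\<close>, so that the names can be natural numbers whatever the type of
  \<open>V\<close>.\<close>

locale finite_part =
  fixes V :: "'a set" and E :: "'a set set" and X :: "'a set"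
    and \<phi> :: "nat \<Rightarrow> 'a \<Rightarrow> 'b" and \<psi> :: "'a set \<Rightarrow> 'b"
  assumes simple: "simple_graph V E" and infinite: "infinite V" and cubic: "cubic V E"
    and bridgeless: "bridgeless V E" and connected: "connected_graph V E"
    and finite_X: "finite X" and X_sub: "X \<subseteq> V"
    and connected_X: "connected_graph X {e \<in> E. e \<subseteq> X}"
    and phi_eq_iff: "\<lbrakk>x \<in> X; y \<in> X; i < 3; j < 3\<rbrakk> \<Longrightarrow> \<phi> i x = \<phi> j y \<longleftrightarrow> i = j \<and> x = y"
    and psi_eq_iff: "\<lbrakk>e \<in> E; f \<in> E; e \<inter> X \<noteq> {}; f \<inter> X \<noteq> {}\<rbrakk> \<Longrightarrow> \<psi> e = \<psi> f \<longleftrightarrow> e = f"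
    and phi_neq_psi: "\<phi> i x \<noteq> \<psi> e"
begin

definition meeting :: "'a set set" where
  "meeting = {e \<in> E. e \<inter> X \<noteq> {}}"

definition leaving :: "'a set set" where
  "leaving = {e \<in> meeting. \<not> e \<subseteq> X}"

text \<open>The vertex \<open>\<psi> e\<close> carries no index \<open>i\<close>, so the three lifts
  of a leaving edge share it. Indexing it by the edge and not by the outer end keeps apart two
  leaving edges with the same end outside \<open>X\<close>, which degree 3 at
  \<open>\<psi> e\<close> requires.\<close>

definition lift :: "nat \<Rightarrow> 'a set \<Rightarrow> 'b set" where
  "lift i e = \<phi> i ` (e \<inter> X) \<union> (if e \<subseteq> X then {} else {\<psi> e})"

definition closure_vertices :: "'b set" where
  "closure_vertices = (\<Union>i<3. \<phi> i ` X) \<union> \<psi> ` leaving"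

definition closure_edges :: "'b set set" where
  "closure_edges = (\<Union>i<3. lift i ` meeting)"

section \<open>Incidence between lifted edges and vertices\<close>

lemma closure_vertices_cases:
  assumes "w \<in> closure_vertices"
  obtains (copy) i x where "i < 3" "x \<in> X" "w = \<phi> i x" | (new) e where "e \<in> leaving" "w = \<psi> e"
  using assms by (auto simp: closure_vertices_def)

lemma phi_in_lift_iff:
  assumes "i < 3" "j < 3" "x \<in> X"
  shows "\<phi> i x \<in> lift j e \<longleftrightarrow> i = j \<and> x \<in> e"
  using assms phi_neq_psi by (auto simp: lift_def phi_eq_iff)

lemma psi_in_lift_iff:
  assumes "e \<in> leaving" "f \<in> meeting"
  shows "\<psi> e \<in> lift i f \<longleftrightarrow> f = e"
proof -
  have "\<psi> e = \<psi> f \<longleftrightarrow> e = f"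
    using assms by (intro psi_eq_iff) (simp_all add: leaving_def meeting_def)
  moreover have "\<psi> e \<notin> \<phi> i ` (f \<inter> X)"
    using phi_neq_psi by (metis imageE)
  moreover have "\<not> e \<subseteq> X"
    using assms by (simp add: leaving_def)
  ultimately show ?thesis
    unfolding lift_def by (cases "f = e") simp_all
qed

lemma edge_cases:
  assumes "e \<in> meeting"
  obtains (inner) x y where "x \<in> X" "y \<in> X" "x \<noteq> y" "e = {x, y}" "lift i e = {\<phi> i x, \<phi> i y}"
  | (leaving) x y where "x \<in> X" "y \<notin> X" "e = {x, y}" "e \<in> leaving" "lift i e = {\<phi> i x, \<psi> e}"
proof -
  have "e \<in> E" "e \<inter> X \<noteq> {}"
    using assms by (simp_all add: meeting_def)
  moreover obtain u v where "u \<noteq> v" "e = {u, v}"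
    using simple \<open>e \<in> E\<close> unfolding simple_graph_def by blast
  ultimately obtain x y where xy: "x \<in> X" "x \<noteq> y" "e = {x, y}"
    by (metis Int_insert_left_if0 Int_empty_left insert_commute)
  show thesis
    by (cases "y \<in> X") (use xy assms that in \<open>auto simp: leaving_def lift_def\<close>)
qed

lemma lift_eq_iff:
  assumes "i < 3" "j < 3" "e \<in> meeting" "f \<in> meeting"
  shows "lift i e = lift j f \<longleftrightarrow> i = j \<and> e = f"
proof
  assume eq: "lift i e = lift j f"
  show "i = j \<and> e = f"
    using \<open>e \<in> meeting\<close>
  proof (cases rule: edge_cases[where i = i])
    case (inner x y)
    then have "\<phi> i x \<in> lift j f" "\<phi> i y \<in> lift j f"
      using eq by auto
    then have "i = j" "x \<in> f" "y \<in> f"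
      using inner assms by (simp_all add: phi_in_lift_iff)
    \<comment> \<open>As \<open>f\<close> contains two distinct vertices of \<open>X\<close>, it
      cannot be a leaving edge and has no further elements.\<close>
    moreover have "f = {x, y}"
      using \<open>f \<in> meeting\<close> by (cases rule: edge_cases[where i = j]) (use calculation inner in auto)
    ultimately show ?thesis
      using inner by simp
  next
    case (leaving x y)
    then have "\<phi> i x \<in> lift j f" "\<psi> e \<in> lift j f"
      using eq by auto
    then show ?thesis
      using leaving assms by (simp add: phi_in_lift_iff psi_in_lift_iff)
  qed
qed simp

lemma meetingI: "\<lbrakk>e \<in> E; x \<in> e; x \<in> X\<rbrakk> \<Longrightarrow> e \<in> meeting"
  by (auto simp: meeting_def)

lemma degree_E: "x \<in> V \<Longrightarrow> card {e \<in> E. x \<in> e} = 3"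
  using cubic by (simp add: cubic_def degree_def)

lemma finite_meeting: "finite meeting"
proof -
  have "meeting = (\<Union>x\<in>X. {e \<in> E. x \<in> e})"
    by (auto simp: meeting_def)
  moreover have "finite {e \<in> E. x \<in> e}" if "x \<in> X" for x
    using degree_E[of x] that X_sub by (intro card_ge_0_finite) auto
  ultimately show ?thesis
    using finite_X by simp
qed

section \<open>The closure is simple and cubic\<close>

lemma simple_closure: "simple_graph closure_vertices closure_edges"
  unfolding simple_graph_def
proof
  fix f assume "f \<in> closure_edges"
  then obtain i e where ie: "i < 3" "e \<in> meeting" "f = lift i e"
    by (auto simp: closure_edges_def)
  show "\<exists>u\<in>closure_vertices. \<exists>v\<in>closure_vertices. u \<noteq> v \<and> f = {u, v}"
    using \<open>e \<in> meeting\<close>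
  proof (cases rule: edge_cases[where i = i])
    case (inner x y)
    then have "\<phi> i x \<noteq> \<phi> i y"
      using ie by (simp add: phi_eq_iff)
    moreover have "\<phi> i x \<in> closure_vertices" "\<phi> i y \<in> closure_vertices"
      using inner ie by (auto simp: closure_vertices_def)
    ultimately show ?thesis
      using inner(5) ie(3) by blast
  next
    case (leaving x y)
    then have "\<phi> i x \<in> closure_vertices" "\<psi> e \<in> closure_vertices"
      using ie by (auto simp: closure_vertices_def)
    then show ?thesis
      using leaving(5) ie(3) phi_neq_psi by blast
  qed
qed

lemma closure_edges_at_phi:
  assumes "i < 3" "x \<in> X"
  shows "{f \<in> closure_edges. \<phi> i x \<in> f} = lift i ` {e \<in> E. x \<in> e}"
  using assms by (auto simp: closure_edges_def phi_in_lift_iff meeting_def)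

lemma cubic_closure: "cubic closure_vertices closure_edges"
  unfolding cubic_def degree_def
proof
  fix w assume "w \<in> closure_vertices"
  then show "card {f \<in> closure_edges. w \<in> f} = 3"
  proof (cases rule: closure_vertices_cases)
    case (copy i x)
    then have "{e \<in> E. x \<in> e} \<subseteq> meeting"
      by (auto simp: meeting_def)
    then have "inj_on (lift i) {e \<in> E. x \<in> e}"
      using copy by (intro inj_onI) (simp add: lift_eq_iff subset_iff)
    then show ?thesis
      using copy X_sub degree_E[of x] by (auto simp: closure_edges_at_phi card_image)
  next
    case (new e)
    then have e: "e \<in> meeting"
      by (simp add: leaving_def)
    \<comment> \<open>Only \<open>e\<close> itself has lifts through \<open>\<psi> e\<close>, one in
      each of the three copies.\<close>
    have "{f \<in> closure_edges. w \<in> f} = (\<lambda>i. lift i e) ` {..<3}"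
      using new e by (auto simp: closure_edges_def psi_in_lift_iff)
    moreover have "inj_on (\<lambda>i. lift i e) {..<3}"
      using e by (intro inj_onI) (simp add: lift_eq_iff)
    ultimately show ?thesis
      by (simp add: card_image)
  qed
qed

section \<open>Connectivity of the closure and absence of bridges\<close>

lemma reach_leaving:
  assumes "x \<in> X"
  shows "\<exists>y e. y \<in> X \<and> y \<in> e \<and> e \<in> leaving - {g} \<and> (x, y) \<in> reach {e \<in> E - {g}. e \<subseteq> X}"
proof -
  \<comment> \<open>A walk in the graph without \<open>g\<close> from \<open>x\<close> to a vertex
    outside the finite set \<open>X\<close> has to leave \<open>X\<close>. Its part up to the first
    exit stays in \<open>X\<close>, and the exit edge differs from \<open>g\<close>.\<close>
  obtain z where z: "z \<in> V" "z \<notin> X"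
    using infinite finite_X by (meson finite_subset subsetI)
  have "(x, z) \<in> reach (E - {g})"
    using connected_graphD[OF connected_delete_edge[OF simple bridgeless connected]] assms z X_sub
    by blast
  then show ?thesis
    using assms
  proof (induction rule: converse_rtrancl_induct)
    case base
    then show ?case
      using z by simp
  next
    case (step x y)
    then have xy: "{x, y} \<in> E - {g}"
      by simp
    show ?case
    proof (cases "y \<in> X")
      case True
      then have "(x, y) \<in> reach {e \<in> E - {g}. e \<subseteq> X}"
        using xy step.prems by (intro reach_edge) auto
      then show ?thesis
        using step.IH[OF True] by (meson rtrancl_trans)
    next
      case False
      then show ?thesis
        using xy step.prems
        by (intro exI[of _ x] exI[of _ "{x, y}"]) (auto simp: leaving_def meeting_def)
    qed
  qed
qed

lemma reach_lift:
  assumes "(x, y) \<in> reach F" "F \<subseteq> {e \<in> E. e \<subseteq> X}" "lift i ` F \<subseteq> H"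
  shows "(\<phi> i x, \<phi> i y) \<in> reach H"
  using assms(1)
proof (induction rule: rtrancl_induct)
  case (step y z)
  then have "lift i {y, z} \<in> H" "{y, z} \<subseteq> X"
    using assms by auto
  then have "{\<phi> i y, \<phi> i z} \<in> H"
    by (simp add: lift_def)
  then show ?case
    using step.IH by (simp add: rtrancl_into_rtrancl)
qed simp

lemma connected_closure_delete:
  assumes g: "g \<in> meeting" and i: "i < 3"
  shows "connected_graph closure_vertices (closure_edges - {lift i g})"
proof -
  let ?H = "closure_edges - {lift i g}"
  \<comment> \<open>The deleted edge belongs to copy \<open>i\<close>, so any other copy is intact
    and can serve as a centre to which everything is connected.\<close>
  define hub where "hub = (if i = 0 then 1 else 0::nat)"
  have hub: "hub < 3" "hub \<noteq> i"
    by (auto simp: hub_def)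
  obtain r where r: "r \<in> X"
    using connected_X by (auto simp: connected_graph_def)
  have lift_H: "lift j e \<in> ?H" if "j < 3" "e \<in> meeting" "j \<noteq> i \<or> e \<noteq> g" for j e
    using that g i by (auto simp: closure_edges_def lift_eq_iff)
  have copy: "(\<phi> j x, \<phi> j y) \<in> reach ?H" if "j < 3" "j \<noteq> i" "x \<in> X" "y \<in> X" for j x y
  proof (rule reach_lift)
    show "(x, y) \<in> reach {e \<in> E. e \<subseteq> X}"
      using connected_graphD[OF connected_X] that by blast
    show "lift j ` {e \<in> E. e \<subseteq> X} \<subseteq> ?H"
    proof (rule image_subsetI)
      fix e assume "e \<in> {e \<in> E. e \<subseteq> X}"
      moreover from this have "e \<noteq> {}"
        using simple_graph_edge(2)[OF simple] by blast
      ultimately have "e \<in> meeting"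
        by (auto simp: meeting_def)
      then show "lift j e \<in> ?H"
        using lift_H that by blast
    qed
  qed auto
  have spoke: "(\<phi> j x, \<psi> e) \<in> reach ?H" if "j < 3" "x \<in> X" "x \<in> e" "e \<in> leaving" "j \<noteq> i \<or> e \<noteq> g"
    for j x e
  proof -
    have e: "e \<in> meeting"
      using that by (simp add: leaving_def)
    then have "lift j e = {\<phi> j x, \<psi> e}"
      by (cases rule: edge_cases[where i = j]) (use that in \<open>auto simp: leaving_def\<close>)
    then show ?thesis
      using lift_H[of j e] e that by (intro reach_edge) simp
  qed
  have psi: "(\<phi> hub r, \<psi> e) \<in> reach ?H" if e: "e \<in> leaving" for e
  proof -
    obtain x where "x \<in> X" "x \<in> e"
      using e by (auto simp: leaving_def meeting_def)
    then show ?thesis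
      using rtrancl_trans[OF copy[of hub r x] spoke[of hub x e]] hub r e by blast
  qed
  have phi: "(\<phi> hub r, \<phi> j x) \<in> reach ?H" if jx: "j < 3" "x \<in> X" for j x
  proof -
    \<comment> \<open>Since both the walk and the exit edge avoid \<open>g\<close>, their lifts
      survive in every copy, so the damaged copy \<open>j = i\<close> needs no separate
      case.\<close>
    obtain y e where ye: "y \<in> X" "y \<in> e" "e \<in> leaving" "e \<noteq> g"
      and xy: "(x, y) \<in> reach {e \<in> E - {g}. e \<subseteq> X}"
      using reach_leaving[OF jx(2), of g] by blast
    have "(\<phi> j x, \<phi> j y) \<in> reach ?H"
    proof (rule reach_lift[OF xy])
      show "lift j ` {e \<in> E - {g}. e \<subseteq> X} \<subseteq> ?H"
      proof (rule image_subsetI)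
        fix e assume e: "e \<in> {e \<in> E - {g}. e \<subseteq> X}"
        then have "e \<noteq> {}"
          using simple_graph_edge(2)[OF simple] by blast
        then have "e \<in> meeting"
          using e by (auto simp: meeting_def)
        then show "lift j e \<in> ?H"
          using lift_H jx e by blast
      qed
    qed auto
    moreover have "(\<phi> j y, \<psi> e) \<in> reach ?H"
      using spoke jx ye by blast
    ultimately have "(\<phi> j x, \<psi> e) \<in> reach ?H"
      by (rule rtrancl_trans)
    then show ?thesis
      by (rule rtrancl_trans[OF psi[OF ye(3)] reach_sym])
  qed
  have "(\<phi> hub r, w) \<in> reach ?H" if "w \<in> closure_vertices" for w
    using that
  proof (cases rule: closure_vertices_cases)
    case (copy j x)
    then show ?thesis
      using phi by simp
  next
    case (new e)
    then show ?thesis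
      using psi by simp
  qed
  moreover have "\<phi> hub r \<in> closure_vertices"
    using hub r by (auto simp: closure_vertices_def)
  ultimately show ?thesis
    by (rule connected_graphI)
qed

text \<open>Restoring a deleted edge preserves connectedness, so it suffices to find one edge to
  delete. A leaving edge comes from \<open>reach_leaving\<close> with the dummy set
  \<open>{}\<close>.\<close>

lemma connected_closure: "connected_graph closure_vertices closure_edges"
proof -
  obtain x where "x \<in> X"
    using connected_X by (auto simp: connected_graph_def)
  then obtain g where "g \<in> leaving"
    using reach_leaving[of x "{}"] by blast
  then have "g \<in> meeting"
    by (simp add: leaving_def)
  then have *: "connected_graph closure_vertices (closure_edges - {lift 0 g})"
    by (rule connected_closure_delete) simp
  have root: "\<phi> 0 x \<in> closure_vertices"
    using \<open>x \<in> X\<close> by (auto simp: closure_vertices_def)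
  show ?thesis
    by (rule connected_graphI[OF reach_mono[OF Diff_subset connected_graphD[OF * root]] root])
qed

lemma bridgeless_closure: "bridgeless closure_vertices closure_edges"
  unfolding bridgeless_def
proof (intro notI, elim exE)
  fix f assume f: "bridge closure_vertices closure_edges f"
  then obtain i e where "i < 3" "e \<in> meeting" "f = lift i e"
    by (auto simp: bridge_def closure_edges_def)
  then have "components closure_vertices (closure_edges - {f}) = {closure_vertices}"
    using components_connected[OF connected_closure_delete] by simp
  then show False
    using f components_connected[OF connected_closure] by (simp add: bridge_def)
qed

lemma finite_closure: "finite closure_vertices"
  using finite_X finite_meeting by (simp add: closure_vertices_def leaving_def)

section \<open>Transfer of perfect matchings to the original graph\<close>

lemma perfect_matching_restrict:
  assumes M: "perfect_matching closure_vertices closure_edges M" and x: "x \<in> X"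
  shows "\<exists>!e. e \<in> E \<and> x \<in> e \<and> lift 0 e \<in> M"
proof -
  have M_sub: "M \<subseteq> closure_edges"
    using M by (simp add: perfect_matching_def)
  have "\<phi> 0 x \<in> closure_vertices"
    using x by (auto simp: closure_vertices_def)
  then have "\<exists>!f. f \<in> M \<and> \<phi> 0 x \<in> f"
    using M by (simp add: perfect_matching_def)
  then obtain f where f: "f \<in> M" "\<phi> 0 x \<in> f" and unique: "\<And>f'. f' \<in> M \<Longrightarrow> \<phi> 0 x \<in> f' \<Longrightarrow> f' = f"
    by blast
  \<comment> \<open>The edges at \<open>\<phi> 0 x\<close> correspond one to one to all the edges at
    \<open>x\<close>, including those that leave \<open>X\<close>, so being matched exactly once
    carries over to \<open>x\<close>.\<close>
  have "f \<in> lift 0 ` {e \<in> E. x \<in> e}"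
    using closure_edges_at_phi[of 0 x] f M_sub x by auto
  then obtain e where e: "e \<in> E" "x \<in> e" "f = lift 0 e"
    by blast
  show ?thesis
  proof (rule ex1I[of _ e])
    fix e' assume e': "e' \<in> E \<and> x \<in> e' \<and> lift 0 e' \<in> M"
    then have "lift 0 e' = lift 0 e"
      using unique[of "lift 0 e'"] e x by (simp add: phi_in_lift_iff)
    then show "e' = e"
      using e e' x meetingI[of _ x] by (simp add: lift_eq_iff)
  next
    show "e \<in> E \<and> x \<in> e \<and> lift 0 e \<in> M"
      using e f(1) by blast
  qed
qed

end

section \<open>From finite graphs to infinite graphs\<close>

text \<open>The variable \<open>f (j, e)\<close> says that \<open>e\<close> lies in matching number
  \<open>j\<close>, and the predicate \<open>Q\<close> lets one argument serve both kinds of cover.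
  Nothing is claimed at the outer ends of edges leaving \<open>X\<close>, where the values read off
  from copy 0 may fail to give a matching.\<close>

lemma finite_part_cover:
  fixes V :: "'a set" and E :: "'a set set" and Q :: "nat \<Rightarrow> bool"
  assumes G: "simple_graph V E" "infinite V" "cubic V E" "bridgeless V E" "connected_graph V E"
    and fin: "\<And>W F. finite_cubic_bridgeless_connected W F \<Longrightarrow>
      \<exists>M. (\<forall>j\<in>{1..k}. perfect_matching W F (M j)) \<and> (\<forall>e\<in>F. Q (card {j \<in> {1..k}. e \<in> M j}))"
    and S: "finite S" "S \<subseteq> V"
  shows "\<exists>f. \<forall>v\<in>S. (\<forall>j\<in>{1..k}. \<exists>!e. e \<in> E \<and> v \<in> e \<and> f (j, e)) \<and>
    (\<forall>e\<in>E. v \<in> e \<longrightarrow> Q (card {j \<in> {1..k::nat}. f (j, e)}))"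
proof -
  obtain X where X: "finite X" "S \<subseteq> X" "X \<subseteq> V" "connected_graph X {e \<in> E. e \<subseteq> X}"
    by (rule finite_connected_superset[OF G(1,5) S])
  have "finite {e \<in> E. x \<in> e}" if "x \<in> X" for x
    using G(3) X(3) that by (intro card_ge_0_finite) (auto simp: cubic_def degree_def)
  then have "finite (\<Union>x\<in>X. {e \<in> E. x \<in> e})"
    using X(1) by simp
  moreover have "(\<Union>x\<in>X. {e \<in> E. x \<in> e}) = {e \<in> E. e \<inter> X \<noteq> {}}"
    by auto
  ultimately have "finite {e \<in> E. e \<inter> X \<noteq> {}}"
    by simp
  \<comment> \<open>The finite graph must have natural numbers as vertices, so \<open>X\<close> and
    the edges meeting it are numbered; these are the sets on which the locale asks for
    injectivity.\<close>
  then obtain \<kappa> :: "'a set \<Rightarrow> nat" where \<kappa>: "inj_on \<kappa> {e \<in> E. e \<inter> X \<noteq> {}}"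
    using finite_imp_inj_to_nat_seg by metis
  obtain \<iota> :: "'a \<Rightarrow> nat" where \<iota>: "inj_on \<iota> X"
    using finite_imp_inj_to_nat_seg X(1) by metis
  \<comment> \<open>The minimum keeps \<open>\<phi> i x\<close> away from the residue class of \<open>\<psi>\<close> modulo 4 even for \<open>i \<ge> 3\<close>.\<close>
  define \<phi> where "\<phi> i x = 4 * \<iota> x + min i 2" for i x
  define \<psi> where "\<psi> e = 4 * \<kappa> e + 3" for e
  interpret finite_part V E X \<phi> \<psi>
  proof
    fix x y i j assume "x \<in> X" "y \<in> X" "i < (3::nat)" "j < (3::nat)"
    moreover have "\<phi> i x = \<phi> j y \<longleftrightarrow> i = j \<and> \<iota> x = \<iota> y"
      using \<open>i < 3\<close> \<open>j < 3\<close> unfolding \<phi>_def by presburger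
    ultimately show "\<phi> i x = \<phi> j y \<longleftrightarrow> i = j \<and> x = y"
      using \<iota> by (auto dest: inj_onD)
  next
    fix e f assume "e \<in> E" "f \<in> E" "e \<inter> X \<noteq> {}" "f \<inter> X \<noteq> {}"
    then show "\<psi> e = \<psi> f \<longleftrightarrow> e = f"
      using \<kappa> by (auto simp: \<psi>_def dest: inj_onD)
  next
    fix i x e
    show "\<phi> i x \<noteq> \<psi> e"
      unfolding \<phi>_def \<psi>_def by presburger
  qed (use G X in auto)
  have "finite_cubic_bridgeless_connected closure_vertices closure_edges"
    unfolding finite_cubic_bridgeless_connected_def
    by (intro conjI simple_closure finite_closure cubic_closure bridgeless_closure connected_closure)
  from fin[OF this] obtain M where
    M: "\<And>j. j \<in> {1..k} \<Longrightarrow> perfect_matching closure_vertices closure_edges (M j)"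
    and Q: "\<And>e. e \<in> closure_edges \<Longrightarrow> Q (card {j \<in> {1..k}. e \<in> M j})"
    by blast
  have "lift 0 e \<in> closure_edges" if "e \<in> E" "v \<in> e" "v \<in> S" for e v
    using that X(2) by (force simp: closure_edges_def meeting_def)
  moreover have "\<exists>!e. e \<in> E \<and> v \<in> e \<and> lift 0 e \<in> M j" if "j \<in> {1..k}" "v \<in> S" for j v
    using perfect_matching_restrict[OF M] X(2) that by blast
  ultimately show ?thesis
    using Q by (intro exI[of _ "\<lambda>(j, e). lift 0 e \<in> M j"]) simp
qed

text \<open>Each vertex contributes one condition, which involves only the \<open>k\<close>
  variables of each of its three edges, so compactness applies to \<open>finite_part_cover\<close>.
  Attaching the multiplicity condition of an edge to its ends leaves no edge out.\<close>

lemma infinite_cover: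
  fixes V :: "'a set" and E :: "'a set set" and Q :: "nat \<Rightarrow> bool"
  assumes G: "simple_graph V E" "infinite V" "cubic V E" "bridgeless V E" "connected_graph V E"
    and fin: "\<And>W F. finite_cubic_bridgeless_connected W F \<Longrightarrow>
      \<exists>M. (\<forall>j\<in>{1..k}. perfect_matching W F (M j)) \<and> (\<forall>e\<in>F. Q (card {j \<in> {1..k}. e \<in> M j}))"
  shows "\<exists>M. (\<forall>j\<in>{1..k}. perfect_matching V E (M j)) \<and> (\<forall>e\<in>E. Q (card {j \<in> {1..k::nat}. e \<in> M j}))"
proof -
  define P where "P v f \<longleftrightarrow> (\<forall>j\<in>{1..k}. \<exists>!e. e \<in> E \<and> v \<in> e \<and> f (j, e)) \<and>
    (\<forall>e\<in>E. v \<in> e \<longrightarrow> Q (card {j \<in> {1..k}. f (j, e)}))" for v f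
  have "\<exists>f. \<forall>v\<in>V. P v f"
  proof (rule propositional_compactness)
    fix v assume "v \<in> V"
    then have "finite {e \<in> E. v \<in> e}"
      using G(3) by (intro card_ge_0_finite) (simp add: cubic_def degree_def)
    then show "finite ({1..k} \<times> {e \<in> E. v \<in> e})"
      by simp
  next
    fix v and f g :: "nat \<times> 'a set \<Rightarrow> bool"
    assume "\<forall>d\<in>{1..k} \<times> {e \<in> E. v \<in> e}. f d = g d"
    then have fg: "f (j, e) = g (j, e)" if "j \<in> {1..k}" "e \<in> E" "v \<in> e" for j e
      using that by blast
    have "(e \<in> E \<and> v \<in> e \<and> f (j, e)) = (e \<in> E \<and> v \<in> e \<and> g (j, e))" if "j \<in> {1..k}" for j e
      using fg that by blast
    moreover have "{j \<in> {1..k}. f (j, e)} = {j \<in> {1..k}. g (j, e)}" if "e \<in> E" "v \<in> e" for e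
      using fg that by blast
    ultimately show "P v f = P v g"
      unfolding P_def by (simp cong: conj_cong)
  next
    fix S assume "finite S" "S \<subseteq> V"
    then show "\<exists>f. \<forall>v\<in>S. P v f"
      unfolding P_def using finite_part_cover[OF G, of k Q] fin by blast
  qed
  then obtain f where f: "\<And>v. v \<in> V \<Longrightarrow> P v f"
    by blast
  \<comment> \<open>The assignment \<open>f\<close> may be true on sets that are not edges, hence
    the intersection with \<open>E\<close>.\<close>
  define M where "M j = {e \<in> E. f (j, e)}" for j
  have "perfect_matching V E (M j)" if "j \<in> {1..k}" for j
    unfolding perfect_matching_def
  proof (intro conjI ballI)
    fix v assume "v \<in> V"
    then have "\<exists>!e. e \<in> E \<and> v \<in> e \<and> f (j, e)"
      using f that by (simp add: P_def)
    then show "\<exists>!e. e \<in> M j \<and> v \<in> e"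
      by (simp add: M_def conj_ac)
  qed (auto simp: M_def)
  moreover have "Q (card {j \<in> {1..k}. e \<in> M j})" if e: "e \<in> E" for e
  proof -
    obtain v where "v \<in> V" "v \<in> e"
      using simple_graph_edge[OF G(1) e] by blast
    then show ?thesis
      using f[of v] e by (simp add: P_def M_def)
  qed
  ultimately show ?thesis
    by blast
qed

theorem theorem3p1:
  fixes V :: "'a set" and E :: "'a set set" and k p :: nat
  assumes "simple_graph V E" and "infinite V" and "cubic V E" and "bridgeless V E"
    and "connected_graph V E"
    and "0 < p" and "0 < k" and "p \<le> k"
  shows "((\<forall>W F. finite_cubic_bridgeless_connected W F \<longrightarrow> has_PM_cover k p W F)
            \<longrightarrow> has_PM_cover k p V E) \<and>
         ((\<forall>W F. finite_cubic_bridgeless_connected W F \<longrightarrow> has_PM_cover_star k p W F)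
            \<longrightarrow> has_PM_cover_star k p V E)"
  using infinite_cover[OF assms(1-5), of k "\<lambda>n. n \<le> p"]
    infinite_cover[OF assms(1-5), of k "\<lambda>n. n \<ge> p"]
  unfolding has_PM_cover_def has_PM_cover_star_def by blast

end
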